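(* Let $G$ be a connected graph of maximum degree $\Delta\ge1$. Then $\chi_{\rm pcf}(G)\le \lfloor 5\Delta/2\rfloor$, with equality if and only if $G=K_2$ or $G=C_5$.
   Context: All graphs are simple, finite and undirected. A vertex coloring of a graph is proper if adjacent vertices get distinct colors. It is conflict-free (with respect to open neighborhoods) if for every non-isolated vertex $x$ there is a color that appears exactly once on the open neighborhood $N(x)$. A PCF $k$-coloring is a vertex coloring with at most $k$ colors that is both proper and conflict-free. The PCF chromatic number $\chi_{\rm pcf}(G)$ is the minimum $k$ for which $G$ admits a PCF $k$-coloring. Equality of graphs such as $G=K_2$ is understood up to isomorphism. *)

theory Defs
  imports Complex_Main "Graph_Theory.Graph_Theory"
begin

text \<open>
  A finite simple undirected graph is a \<^locale>\<open>pair_graph\<close>: every edge is represented by its two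
  opposite arcs. Hence the degree of a vertex is its out-degree.
\<close>

definition nbhd :: "'a pair_pre_digraph \<Rightarrow> 'a \<Rightarrow> 'a set" where
  "nbhd G x = {y. (x, y) \<in> parcs G}"

definition max_degree :: "'a pair_pre_digraph \<Rightarrow> nat" where
  "max_degree G = Max (out_degree (with_proj G) ` pverts G)"

definition proper_coloring :: "'a pair_pre_digraph \<Rightarrow> ('a \<Rightarrow> nat) \<Rightarrow> bool" where
  "proper_coloring G c \<longleftrightarrow> (\<forall>(x, y) \<in> parcs G. c x \<noteq> c y)"

definition conflict_free :: "'a pair_pre_digraph \<Rightarrow> ('a \<Rightarrow> nat) \<Rightarrow> bool" where
  "conflict_free G c \<longleftrightarrow>
     (\<forall>x \<in> pverts G. nbhd G x \<noteq> {} \<longrightarrow> (\<exists>i. card {y \<in> nbhd G x. c y = i} = 1))"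

definition pcf_coloring :: "'a pair_pre_digraph \<Rightarrow> nat \<Rightarrow> ('a \<Rightarrow> nat) \<Rightarrow> bool" where
  "pcf_coloring G k c \<longleftrightarrow>
     card (c ` pverts G) \<le> k \<and> proper_coloring G c \<and> conflict_free G c"

definition pcf_chromatic_number :: "'a pair_pre_digraph \<Rightarrow> nat" where
  "pcf_chromatic_number G = (LEAST k. \<exists>c. pcf_coloring G k c)"

text \<open>The cycle $C_n$; it is a simple cycle only for $n \ge 3$.\<close>

definition cycle_graph :: "nat \<Rightarrow> nat pair_pre_digraph" where
  "cycle_graph n = \<lparr> pverts = {..<n},
     parcs = {(i, j). i < n \<and> j < n \<and> (j = Suc i mod n \<or> i = Suc j mod n)} \<rparr>"

lemma pair_graph_cycle_graph:
  assumes "n \<ge> 3"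
  shows "pair_graph (cycle_graph n)"
proof
  have "parcs (cycle_graph n) \<subseteq> {..<n} \<times> {..<n}"
    by (auto simp: cycle_graph_def)
  then show "finite (parcs (cycle_graph n))"
    by (rule finite_subset) simp
next
  fix e assume "e \<in> parcs (cycle_graph n)"
  then show "fst e \<noteq> snd e"
    using assms by (auto simp: cycle_graph_def mod_Suc split: if_splits)
qed (auto simp: cycle_graph_def symmetric_def sym_def)

text \<open>An injective coloring is a PCF coloring, so the minimum defining
  \<^const>\<open>pcf_chromatic_number\<close> is attained.\<close>

lemma pcf_coloring_exists:
  assumes "pair_graph G"
  shows "\<exists>c. pcf_coloring G (card (pverts G)) c"
proof -
  interpret pair_graph G by fact
  obtain c :: "'a \<Rightarrow> nat" where inj: "inj_on c (pverts G)"
    using finite_imp_inj_to_nat_seg[OF pair_finite_verts] by blast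
  have "proper_coloring G c"
    unfolding proper_coloring_def
    using inj pair_no_loops wellformed' by (fastforce dest: inj_onD)
  moreover have "conflict_free G c"
    unfolding conflict_free_def
  proof (intro ballI impI)
    fix x assume "nbhd G x \<noteq> {}"
    then obtain y where y: "y \<in> nbhd G x" by blast
    have "{z \<in> nbhd G x. c z = c y} = {y}"
      using y inj wellformed' by (auto simp: nbhd_def dest: inj_onD)
    then show "\<exists>i. card {z \<in> nbhd G x. c z = i} = 1"
      by (intro exI[of _ "c y"]) simp
  qed
  ultimately show ?thesis
    by (auto simp: pcf_coloring_def intro: card_image_le pair_finite_verts)
qed

end

theory Submission
  imports Defs
begin

text \<open>
  Color the vertices greedily in some order, letting each vertex \<open>v\<close> avoid the colors of its earlier
  neighbors and, for each neighbor \<open>x\<close> of \<open>v\<close>, the color of the first neighbor of \<open>x\<close>. That color is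
  then unique in the neighborhood of \<open>x\<close>, and \<open>2\<Delta> + 1\<close> colors suffice, which is less than
  \<open>\<lfloor>5\<Delta>/2\<rfloor>\<close> for \<open>\<Delta> \<ge> 4\<close>. If some vertex of a connected graph has degree less than \<open>\<Delta>\<close>, an order that
  ends with it and in which all other vertices have a later neighbor saves one color. In a cubic
  graph the last vertex may ignore the constraints at its neighbors, which again saves one color.
  Among the remaining graphs, the cycles, only \<open>C\<^sub>5\<close> needs more than four colors.
\<close>

section \<open>Greedy colorings\<close>

text \<open>Vertices are added by increasing \<open>f\<close>, so the vertices in \<open>F v\<close>
  block fewer than \<open>k\<close> colors when \<open>v\<close> gets its own. \<open>F v\<close> is
  arbitrary rather than a set of neighbors, which leaves room for the witness constraints.\<close>

lemma greedy_coloring: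
  fixes f :: "'a \<Rightarrow> 'b::linorder" and F :: "'a \<Rightarrow> 'a set"
  assumes "finite V"
    and "\<And>v u. v \<in> V \<Longrightarrow> u \<in> F v \<Longrightarrow> f u < f v"
    and "\<And>v. v \<in> V \<Longrightarrow> finite (F v) \<and> card (F v) < k"
  shows "\<exists>c :: 'a \<Rightarrow> nat. \<forall>v\<in>V. c v < k \<and> (\<forall>u\<in>F v. c u \<noteq> c v)"
  using assms
proof (induction V rule: finite_ranking_induct[where f = f])
  case empty
  then show ?case by simp
next
  case (insert x S)
  then obtain c where c: "\<forall>v\<in>S. c v < k \<and> (\<forall>u\<in>F v. c u \<noteq> c v)"
    by (metis insertI2)
  have fx: "finite (F x)" "card (F x) < k" using insert.prems(2) by auto
  then have "card (c ` F x) < k"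
    using card_image_le le_less_trans by blast
  then have "\<not> {..<k} \<subseteq> c ` F x"
    using fx card_mono[of "c ` F x" "{..<k}"] by auto
  then obtain i where i: "i < k" "i \<notin> c ` F x" by auto
  show ?case
  proof (cases "x \<in> S")
    case True
    then show ?thesis using c by (metis insert_absorb)
  next
    case False
    \<comment> \<open>The new vertex has the largest rank, so changing its color disturbs no
      constraint of a vertex colored before.\<close>
    have "x \<notin> F v" if "v \<in> insert x S" for v
      using that insert.hyps(2) insert.prems(1) by (metis insert_iff leD less_irrefl)
    then show ?thesis
      using c i False by (intro exI[of _ "c(x := i)"]) auto
  qed
qed

section \<open>Graphs and their colorings\<close>

lemma connected_imp_verts_nonempty:
  assumes "connected (with_proj G)"
  shows "pverts G \<noteq> {}"
  using assms by (auto simp: connected_def strongly_connected_def)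

lemma pcf_chromatic_number_le:
  "pcf_coloring G k c \<Longrightarrow> pcf_chromatic_number G \<le> k"
  unfolding pcf_chromatic_number_def by (rule Least_le) blast

lemma pcf_chromatic_number_attained:
  assumes "pair_graph G"
  shows "\<exists>c. pcf_coloring G (pcf_chromatic_number G) c"
  unfolding pcf_chromatic_number_def
  by (rule LeastI_ex) (use pcf_coloring_exists[OF assms] in blast)

text \<open>Trades unique colors for witness vertices, which is the form in which the greedy and the
  cyclic colorings provide them.\<close>

lemma pcf_coloringI:
  assumes "\<And>v. v \<in> pverts G \<Longrightarrow> c v < k"
    and "proper_coloring G c"
    and "\<And>x. x \<in> pverts G \<Longrightarrow> nbhd G x \<noteq> {} \<Longrightarrow>
           \<exists>y \<in> nbhd G x. \<forall>z \<in> nbhd G x. z \<noteq> y \<longrightarrow> c z \<noteq> c y"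
  shows "pcf_coloring G k c"
proof -
  have "card (c ` pverts G) \<le> card {..<k}"
    by (rule card_mono) (use assms(1) in auto)
  moreover have "conflict_free G c"
    unfolding conflict_free_def
  proof (intro ballI impI)
    fix x assume "x \<in> pverts G" "nbhd G x \<noteq> {}"
    from assms(3)[OF this] obtain y
      where y: "y \<in> nbhd G x" "\<forall>z \<in> nbhd G x. z \<noteq> y \<longrightarrow> c z \<noteq> c y" by blast
    then have "{z \<in> nbhd G x. c z = c y} = {y}" by blast
    then show "\<exists>i. card {z \<in> nbhd G x. c z = i} = 1"
      by (intro exI[of _ "c y"]) simp
  qed
  ultimately show ?thesis using assms(2) by (simp add: pcf_coloring_def)
qed

section \<open>Neighborhoods, degrees and connectivity\<close>

context pair_graph
begin

lemma finite_nbhd: "finite (nbhd G x)"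
  by (rule finite_subset[OF _ pair_finite_verts]) (auto simp: nbhd_def wellformed')

lemma nbhd_subset: "nbhd G x \<subseteq> pverts G"
  by (auto simp: nbhd_def wellformed')

lemma nbhd_irrefl: "x \<notin> nbhd G x"
  using pair_no_loops[of "(x, x)"] by (auto simp: nbhd_def)

lemma nbhd_sym: "y \<in> nbhd G x \<longleftrightarrow> x \<in> nbhd G y"
  using arcs_symmetric by (auto simp: nbhd_def)

lemma out_degree_eq_card_nbhd: "out_degree (with_proj G) x = card (nbhd G x)"
proof -
  have "out_arcs (with_proj G) x = Pair x ` nbhd G x"
    by (auto simp: out_arcs_def nbhd_def)
  then show ?thesis
    by (simp add: out_degree_def card_image inj_on_def)
qed

lemma card_nbhd_le: "x \<in> pverts G \<Longrightarrow> card (nbhd G x) \<le> max_degree G"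
  unfolding max_degree_def using pair_finite_verts
  by (intro Max_ge) (auto simp: out_degree_eq_card_nbhd[symmetric])

lemma max_degree_attained:
  assumes "pverts G \<noteq> {}"
  obtains x where "x \<in> pverts G" "card (nbhd G x) = max_degree G"
proof -
  have "max_degree G \<in> out_degree (with_proj G) ` pverts G"
    unfolding max_degree_def using assms pair_finite_verts by (intro Max_in) auto
  then show thesis using that by (auto simp: out_degree_eq_card_nbhd)
qed

text \<open>Arcs are symmetric, so every vertex is reachable from \<open>r\<close>, and no walk can
  leave \<open>S\<close>. This is how connectivity enters all constructions below.\<close>

lemma nbhd_closed_eq_verts:
  assumes "connected (with_proj G)" "S \<subseteq> pverts G" "r \<in> S"
    and "\<And>x. x \<in> S \<Longrightarrow> nbhd G x \<subseteq> S"
  shows "S = pverts G"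
proof -
  have "v \<in> S" if "v \<in> pverts G" for v
  proof -
    have "strongly_connected (with_proj G)"
      using assms(1) pair_sym_arcs symmetric_connected_imp_strongly_connected by blast
    then have "r \<rightarrow>\<^sup>*\<^bsub>with_proj G\<^esub> v"
      using that assms(2,3) by (auto simp: strongly_connected_def)
    then show ?thesis
    proof (induction rule: reachable_induct)
      case base
      then show ?case using assms by blast
    next
      case (step x y)
      then show ?case using assms(4)[of x] by (auto simp: nbhd_def)
    qed
  qed
  then show ?thesis using assms by blast
qed

text \<open>The vertex \<open>w x\<close> is the first neighbor of \<open>x\<close> in the order \<open>f\<close>; it gets a color that no other
  neighbor of \<open>x\<close> outside \<open>A\<close> repeats, so that each \<open>v\<close> has at most \<open>deg v\<close> extra constraints.\<close>

lemma witness_coloring: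
  fixes f :: "'a \<Rightarrow> 'b::linorder"
  assumes inj: "inj_on f (pverts G)"
    and w: "\<And>x y. y \<in> nbhd G x \<Longrightarrow> w x \<in> nbhd G x \<and> f (w x) \<le> f y"
    and bound: "\<And>v. v \<in> pverts G \<Longrightarrow>
      card {u \<in> nbhd G v. f u < f v} + (if v \<in> A then 0 else card (nbhd G v)) < k"
  obtains c :: "'a \<Rightarrow> nat" where "\<And>v. v \<in> pverts G \<Longrightarrow> c v < k"
    and "proper_coloring G c"
    and "\<And>x y. y \<in> nbhd G x \<Longrightarrow> y \<notin> A \<Longrightarrow> y \<noteq> w x \<Longrightarrow> c y \<noteq> c (w x)"
proof -
  \<comment> \<open>The witness constraints on \<open>v\<close>, one for each neighbor;
    \<open>v\<close> is removed because it may itself be the witness of a neighbor.\<close>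
  define W where "W v = (if v \<in> A then {} else w ` nbhd G v - {v})" for v
  define F where "F v = {u \<in> nbhd G v. f u < f v} \<union> W v" for v
  have less: "f (w x) < f v" if "v \<in> nbhd G x" "w x \<noteq> v" for v x
    using w[OF that(1)] that inj nbhd_subset[of x] by (auto simp: order_le_less dest: inj_onD)
  have cardW: "card (W v) \<le> (if v \<in> A then 0 else card (nbhd G v))" for v
    using finite_nbhd[of v] card_image_le[of "nbhd G v" w] card_Diff1_le[of "w ` nbhd G v" v]
    by (auto simp: W_def)
  have "\<exists>c :: 'a \<Rightarrow> nat. \<forall>v\<in>pverts G. c v < k \<and> (\<forall>u\<in>F v. c u \<noteq> c v)"
  proof (rule greedy_coloring[where f = f])
    fix v u assume "v \<in> pverts G" "u \<in> F v"
    then show "f u < f v"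
      using less nbhd_sym by (auto simp: F_def W_def split: if_splits)
  next
    fix v assume v: "v \<in> pverts G"
    have "card (F v) \<le> card {u \<in> nbhd G v. f u < f v} + card (W v)"
      unfolding F_def by (rule card_Un_le)
    also have "\<dots> < k" using bound[OF v] cardW[of v] by linarith
    finally show "finite (F v) \<and> card (F v) < k"
      using finite_nbhd by (auto simp: F_def W_def)
  qed (rule pair_finite_verts)
  then obtain c :: "'a \<Rightarrow> nat" where c: "\<And>v. v \<in> pverts G \<Longrightarrow> c v < k"
    "\<And>u v. v \<in> pverts G \<Longrightarrow> u \<in> F v \<Longrightarrow> c u \<noteq> c v" by blast
  show thesis
  proof
    show "c v < k" if "v \<in> pverts G" for v using c that by blast
    have "c x \<noteq> c y" if xy: "(x, y) \<in> parcs G" for x y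
    proof -
      have "x \<in> pverts G" "y \<in> pverts G" "x \<in> nbhd G y" "y \<in> nbhd G x" "x \<noteq> y"
        using xy wellformed' nbhd_sym[of y x] nbhd_irrefl by (auto simp: nbhd_def)
      \<comment> \<open>Whichever end of the edge comes later has avoided the color of the
        other.\<close>
      moreover from this have "f x < f y \<or> f y < f x"
        using inj by (metis inj_onD linorder_less_linear)
      ultimately show ?thesis using c(2)[of x y] c(2)[of y x] by (auto simp: F_def)
    qed
    then show "proper_coloring G c" by (auto simp: proper_coloring_def)
    show "c y \<noteq> c (w x)" if "y \<in> nbhd G x" "y \<notin> A" "y \<noteq> w x" for x y
    proof -
      have "w x \<in> F y" using that nbhd_sym[of y x] by (auto simp: F_def W_def)
      then show ?thesis using c(2)[of y "w x"] that nbhd_subset[of x] by auto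
    qed
  qed
qed

section \<open>Upper bounds from vertex orders\<close>

lemma first_neighbor_exists:
  fixes f :: "'a \<Rightarrow> 'b::linorder"
  obtains w where "\<And>x y. y \<in> nbhd G x \<Longrightarrow> w x \<in> nbhd G x \<and> f (w x) \<le> f y"
proof
  fix x y assume y: "y \<in> nbhd G x"
  then have "nbhd G x \<noteq> {}" by blast
  with y show "arg_min_on f (nbhd G x) \<in> nbhd G x \<and> f (arg_min_on f (nbhd G x)) \<le> f y"
    using arg_min_if_finite(1)[OF finite_nbhd, of x f] arg_min_least[OF finite_nbhd, of x y f]
    by blast
qed

text \<open>The case of an empty \<open>A\<close>: every vertex respects all witnesses, so
  \<open>w x\<close> carries a unique color around \<open>x\<close>.\<close>

lemma pcf_chromatic_number_le_of_order:
  fixes f :: "'a \<Rightarrow> 'b::linorder"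
  assumes inj: "inj_on f (pverts G)"
    and bound: "\<And>v. v \<in> pverts G \<Longrightarrow>
      card {u \<in> nbhd G v. f u < f v} + card (nbhd G v) < k"
  shows "pcf_chromatic_number G \<le> k"
proof -
  obtain w where w: "\<And>x y. y \<in> nbhd G x \<Longrightarrow> w x \<in> nbhd G x \<and> f (w x) \<le> f y"
    using first_neighbor_exists[of f] by blast
  have "card {u \<in> nbhd G v. f u < f v} + (if v \<in> {} then 0 else card (nbhd G v)) < k"
    if "v \<in> pverts G" for v using bound[OF that] by simp
  then obtain c :: "'a \<Rightarrow> nat" where c: "\<And>v. v \<in> pverts G \<Longrightarrow> c v < k" "proper_coloring G c"
    "\<And>x y. y \<in> nbhd G x \<Longrightarrow> y \<notin> {} \<Longrightarrow> y \<noteq> w x \<Longrightarrow> c y \<noteq> c (w x)"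
    using witness_coloring[OF inj w, of "{}" k] by blast
  have "pcf_coloring G k c"
  proof (rule pcf_coloringI[OF c(1,2)])
    fix x assume "nbhd G x \<noteq> {}"
    then show "\<exists>y \<in> nbhd G x. \<forall>z \<in> nbhd G x. z \<noteq> y \<longrightarrow> c z \<noteq> c y"
      using w c(3) by (intro bexI[of _ "w x"]) auto
  qed
  then show ?thesis by (rule pcf_chromatic_number_le)
qed

text \<open>Any order will do, since both summands of the bound are at most the maximum
  degree.\<close>

lemma pcf_chromatic_number_le_greedy:
  "pcf_chromatic_number G \<le> 2 * max_degree G + 1"
proof -
  obtain f :: "'a \<Rightarrow> nat" where "inj_on f (pverts G)"
    using finite_imp_inj_to_nat_seg[OF pair_finite_verts] by blast
  then show ?thesis
  proof (rule pcf_chromatic_number_le_of_order)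
    fix v assume "v \<in> pverts G"
    moreover have "card {u \<in> nbhd G v. f u < f v} \<le> card (nbhd G v)"
      by (rule card_mono) (auto simp: finite_nbhd)
    ultimately show "card {u \<in> nbhd G v. f u < f v} + card (nbhd G v) < 2 * max_degree G + 1"
      using card_nbhd_le[of v] by linarith
  qed
qed

text \<open>The order is built backwards from \<open>r\<close>. A maximal set \<open>S\<close> with
  such an order is closed under neighbors: a missing neighbor \<open>y\<close> of some
  \<open>x\<close> in \<open>S\<close> could be put before all of \<open>S\<close>, with
  \<open>x\<close> as its later neighbor.\<close>

lemma connected_order:
  assumes conn: "connected (with_proj G)" and r: "r \<in> pverts G"
  obtains f :: "'a \<Rightarrow> int" where "inj_on f (pverts G)"
    and "\<And>v. v \<in> pverts G \<Longrightarrow> f v \<le> f r"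
    and "\<And>v. v \<in> pverts G \<Longrightarrow> v \<noteq> r \<Longrightarrow> \<exists>u \<in> nbhd G v. f v < f u"
proof -
  define P where "P S \<longleftrightarrow> S \<subseteq> pverts G \<and> r \<in> S \<and> (\<exists>f :: 'a \<Rightarrow> int. inj_on f S \<and>
      (\<forall>v\<in>S. f v \<le> f r \<and> (v \<noteq> r \<longrightarrow> (\<exists>u \<in> nbhd G v \<inter> S. f v < f u))))" for S
  have "finite {S. P S}"
    by (rule finite_subset[of _ "Pow (pverts G)"]) (auto simp: P_def pair_finite_verts)
  moreover have "{r} \<in> {S. P S}" using r by (auto simp: P_def)
  ultimately obtain S where S: "P S" and max: "\<And>T. P T \<Longrightarrow> S \<subseteq> T \<Longrightarrow> S = T"
    using finite_has_maximal[of "{S. P S}"] by blast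
  from S obtain f :: "'a \<Rightarrow> int" where f: "S \<subseteq> pverts G" "r \<in> S" "inj_on f S"
    "\<And>v. v \<in> S \<Longrightarrow> f v \<le> f r"
    "\<And>v. v \<in> S \<Longrightarrow> v \<noteq> r \<Longrightarrow> \<exists>u \<in> nbhd G v \<inter> S. f v < f u" by (auto simp: P_def)
  have "S = pverts G"
  proof (rule nbhd_closed_eq_verts[OF conn f(1,2)])
    fix x assume x: "x \<in> S"
    show "nbhd G x \<subseteq> S"
    proof (rule ccontr)
      assume "\<not> nbhd G x \<subseteq> S"
      then obtain y where y: "y \<in> nbhd G x" "y \<notin> S" by blast
      \<comment> \<open>Ranks are integers so that there is always room below the current
        minimum.\<close>
      define m where "m = Min (f ` S) - 1"
      have fin: "finite S" using f(1) pair_finite_verts finite_subset by blast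
      have m: "m < f v" if "v \<in> S" for v
      proof -
        have "Min (f ` S) \<le> f v" using that fin by simp
        then show ?thesis by (simp add: m_def)
      qed
      define g where "g = f(y := m)"
      have gS: "g v = f v" if "v \<in> S" for v using that y by (auto simp: g_def)
      have gy: "g y = m" by (simp add: g_def)
      have "P (insert y S)"
        unfolding P_def
      proof (intro conjI exI[of _ g] ballI)
        show "insert y S \<subseteq> pverts G" using f(1) y nbhd_subset by blast
        show "r \<in> insert y S" using f(2) by simp
        show "inj_on g (insert y S)"
          using f(3) m y gS gy by (fastforce simp: inj_on_def)
        fix v assume v: "v \<in> insert y S"
        show "g v \<le> g r" using v f(2,4) m gS gy by (cases "v = y") (auto simp: less_imp_le)
        show "v \<noteq> r \<longrightarrow> (\<exists>u\<in>nbhd G v \<inter> insert y S. g v < g u)"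
        proof (cases "v = y")
          case True
          moreover have "x \<in> nbhd G y" using y(1) nbhd_sym by blast
          ultimately show ?thesis using x m[OF x] gS[OF x] gy by (intro impI bexI[of _ x]) auto
        next
          case False
          then have "v \<in> S" using v by simp
          show ?thesis
          proof
            assume "v \<noteq> r"
            then obtain u where "u \<in> nbhd G v" "u \<in> S" "f v < f u"
              using f(5)[OF \<open>v \<in> S\<close>] by blast
            then show "\<exists>u\<in>nbhd G v \<inter> insert y S. g v < g u"
              using gS \<open>v \<in> S\<close> by (intro bexI[of _ u]) auto
          qed
        qed
      qed
      from max[OF this] y(2) show False by blast
    qed
  qed
  then show thesis using that[of f] f by blast
qed

lemma card_earlier_neighbors_less:
  fixes f :: "'a \<Rightarrow> int"
  assumes "u \<in> nbhd G v" "f v < f u"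
  shows "card {u \<in> nbhd G v. f u < f v} < card (nbhd G v)"
proof (rule psubset_card_mono)
  have "u \<notin> {u \<in> nbhd G v. f u < f v}" using assms by simp
  then show "{u \<in> nbhd G v. f u < f v} \<subset> nbhd G v" using assms by blast
qed (rule finite_nbhd)

text \<open>In an order that ends with \<open>r\<close>, every other vertex saves one constraint
  through its later neighbor, while \<open>r\<close> saves through its smaller degree.\<close>

lemma pcf_chromatic_number_le_irregular:
  assumes conn: "connected (with_proj G)"
    and r: "r \<in> pverts G" "card (nbhd G r) < max_degree G"
  shows "pcf_chromatic_number G \<le> 2 * max_degree G"
proof -
  obtain f :: "'a \<Rightarrow> int" where f: "inj_on f (pverts G)"
    "\<And>v. v \<in> pverts G \<Longrightarrow> v \<noteq> r \<Longrightarrow> \<exists>u \<in> nbhd G v. f v < f u"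
    using connected_order[OF conn r(1)] by metis
  from f(1) show ?thesis
  proof (rule pcf_chromatic_number_le_of_order)
    fix v assume v: "v \<in> pverts G"
    have le: "card {u \<in> nbhd G v. f u < f v} \<le> card (nbhd G v)"
      by (rule card_mono) (auto simp: finite_nbhd)
    show "card {u \<in> nbhd G v. f u < f v} + card (nbhd G v) < 2 * max_degree G"
    proof (cases "v = r")
      case True
      then show ?thesis using le r by simp
    next
      case False
      then obtain u where "u \<in> nbhd G v" "f v < f u" using f(2)[OF v] by blast
      from card_earlier_neighbors_less[of u v f, OF this] show ?thesis
        using card_nbhd_le[OF v] by linarith
    qed
  qed
qed

text \<open>The last vertex \<open>r\<close> of the order needs no witness constraints: the other two neighbors of a
  neighbor of \<open>r\<close> have distinct colors, and whatever the color of \<open>r\<close>, one of them is not repeated.\<close>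

lemma pcf_chromatic_number_le_cubic:
  assumes conn: "connected (with_proj G)"
    and cubic: "\<And>v. v \<in> pverts G \<Longrightarrow> card (nbhd G v) = 3"
  shows "pcf_chromatic_number G \<le> 6"
proof -
  obtain r where r: "r \<in> pverts G" using connected_imp_verts_nonempty[OF conn] by blast
  obtain f :: "'a \<Rightarrow> int" where f: "inj_on f (pverts G)"
    "\<And>v. v \<in> pverts G \<Longrightarrow> f v \<le> f r"
    "\<And>v. v \<in> pverts G \<Longrightarrow> v \<noteq> r \<Longrightarrow> \<exists>u \<in> nbhd G v. f v < f u"
    using connected_order[OF conn r] by metis
  obtain w where w: "\<And>x y. y \<in> nbhd G x \<Longrightarrow> w x \<in> nbhd G x \<and> f (w x) \<le> f y"
    using first_neighbor_exists[of f] by blast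
  \<comment> \<open>At most 3 constraints at \<open>r\<close>, and at most 2 + 3 elsewhere.\<close>
  have bound: "card {u \<in> nbhd G v. f u < f v} + (if v \<in> {r} then 0 else card (nbhd G v)) < 6"
    if v: "v \<in> pverts G" for v
  proof (cases "v = r")
    case True
    have "card {u \<in> nbhd G v. f u < f v} \<le> card (nbhd G v)"
      by (rule card_mono) (auto simp: finite_nbhd)
    then show ?thesis using True cubic[OF v] by simp
  next
    case False
    then obtain u where "u \<in> nbhd G v" "f v < f u" using f(3)[OF v] by blast
    from card_earlier_neighbors_less[of u v f, OF this] show ?thesis
      using False cubic[OF v] by simp
  qed
  obtain c :: "'a \<Rightarrow> nat" where c: "\<And>v. v \<in> pverts G \<Longrightarrow> c v < 6" "proper_coloring G c"
    "\<And>x y. y \<in> nbhd G x \<Longrightarrow> y \<notin> {r} \<Longrightarrow> y \<noteq> w x \<Longrightarrow> c y \<noteq> c (w x)"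
    using witness_coloring[OF f(1) w bound] by blast
  have "pcf_coloring G 6 c"
  proof (rule pcf_coloringI[OF c(1,2)])
    fix x assume x: "x \<in> pverts G" and "nbhd G x \<noteq> {}"
    then have wx: "w x \<in> nbhd G x" using w by auto
    have card2: "card (nbhd G x - {w x}) = 2"
      using wx cubic[OF x] by (simp add: finite_nbhd)
    \<comment> \<open>The witness \<open>w x\<close> can fail only if \<open>r\<close> repeats its
      color. Then the third neighbor, which still avoids the color of \<open>w x\<close>, has a
      unique color.\<close>
    show "\<exists>y \<in> nbhd G x. \<forall>z \<in> nbhd G x. z \<noteq> y \<longrightarrow> c z \<noteq> c y"
    proof (cases "r \<in> nbhd G x \<and> c r = c (w x)")
      case False
      then show ?thesis using wx c(3)[of _ x] by (intro bexI[of _ "w x"]) auto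
    next
      case True
      \<comment> \<open>If the first neighbor of \<open>x\<close> were the last vertex of the whole
        order, it would be the only neighbor.\<close>
      have "w x \<noteq> r"
      proof
        assume "w x = r"
        have "z = r" if "z \<in> nbhd G x" for z
        proof -
          have z: "z \<in> pverts G" using that nbhd_subset by blast
          then have "f z = f r" using w[OF that] f(2)[OF z] \<open>w x = r\<close> by simp
          then show ?thesis using f(1) r z by (auto dest: inj_onD)
        qed
        then have "nbhd G x \<subseteq> {r}" by blast
        then show False using cubic[OF x] card_mono[of "{r}" "nbhd G x"] by simp
      qed
      then have "card (nbhd G x - {w x} - {r}) = 1"
        using card2 True by simp
      then obtain y where "nbhd G x - {w x} - {r} = {y}" by (auto simp: card_1_singleton_iff)
      then have "nbhd G x = {w x, r, y}" "y \<notin> {r}" "y \<noteq> w x" using wx True by auto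
      then show ?thesis using True c(3)[of y x] by (intro bexI[of _ y]) auto
    qed
  qed
  then show ?thesis by (rule pcf_chromatic_number_le)
qed

end

section \<open>Isomorphisms\<close>

text \<open>Isomorphism as a map of vertices alone, easier to handle than
  \<open>digraph_iso\<close>, whose isomorphisms also carry maps for arcs, heads and tails.\<close>

definition pair_iso :: "('a \<Rightarrow> 'b) \<Rightarrow> 'a pair_pre_digraph \<Rightarrow> 'b pair_pre_digraph \<Rightarrow> bool" where
  "pair_iso h G H \<longleftrightarrow> bij_betw h (pverts G) (pverts H) \<and>
     (\<forall>x \<in> pverts G. \<forall>y \<in> pverts G. (x, y) \<in> parcs G \<longleftrightarrow> (h x, h y) \<in> parcs H)"

text \<open>Arcs are pairs of vertices here, so the vertex map determines the arc map: it must be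
  \<open>map_prod h h\<close>.\<close>

lemma digraph_iso_with_proj_iff:
  fixes G :: "'a pair_pre_digraph" and H :: "'b pair_pre_digraph"
  assumes "pair_graph G" "pair_graph H"
  shows "digraph_iso (with_proj G) (with_proj H) \<longleftrightarrow> (\<exists>h. pair_iso h G H)"
proof -
  interpret G: pair_graph G by fact
  interpret H: pair_graph H by fact
  show ?thesis
  proof
    assume "digraph_iso (with_proj G) (with_proj H)"
    then obtain f where hom: "G.digraph_isomorphism f"
      and H: "with_proj H = app_iso f (with_proj G)"
      unfolding digraph_iso_def by blast
    let ?h = "iso_verts f"
    have V: "pverts H = ?h ` pverts G"
      and E: "parcs H = iso_arcs f ` parcs G"
      and tail: "iso_tail f = fst" and head: "iso_head f = snd"
      using arg_cong[OF H, of verts] arg_cong[OF H, of arcs]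
        arg_cong[OF H, of tail] arg_cong[OF H, of head] by auto
    have inj: "inj_on ?h (pverts G)" using hom by (auto simp: G.digraph_isomorphism_def)
    \<comment> \<open>Tail and head in \<open>H\<close> are the projections, so the images of the
      two ends fix both components.\<close>
    have arc: "iso_arcs f a = (?h (fst a), ?h (snd a))" if "a \<in> parcs G" for a
      using hom that tail head by (auto simp: G.digraph_isomorphism_def prod_eq_iff)
    have "(x, y) \<in> parcs G \<longleftrightarrow> (?h x, ?h y) \<in> parcs H"
      if "x \<in> pverts G" "y \<in> pverts G" for x y
    proof
      assume "(x, y) \<in> parcs G"
      then have "iso_arcs f (x, y) = (?h x, ?h y)" using arc[of "(x, y)"] by simp
      moreover have "iso_arcs f (x, y) \<in> parcs H" using E \<open>(x, y) \<in> parcs G\<close> by blast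
      ultimately show "(?h x, ?h y) \<in> parcs H" by simp
    next
      assume "(?h x, ?h y) \<in> parcs H"
      then obtain a where a: "a \<in> parcs G" "(?h x, ?h y) = iso_arcs f a"
        using E by blast
      then have "?h (fst a) = ?h x" "?h (snd a) = ?h y" using arc[OF a(1)] by auto
      then have "fst a = x" "snd a = y"
        using inj that G.arc_fst_in_verts[OF a(1)] G.arc_snd_in_verts[OF a(1)]
        by (auto dest: inj_onD)
      then have "a = (x, y)" by (simp add: prod_eq_iff)
      then show "(x, y) \<in> parcs G" using a by simp
    qed
    then have "pair_iso ?h G H" using inj V by (auto simp: pair_iso_def bij_betw_def)
    then show "\<exists>h. pair_iso h G H" by blast
  next
    assume "\<exists>h. pair_iso h G H"
    then obtain h where h: "bij_betw h (pverts G) (pverts H)"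
      "\<And>x y. x \<in> pverts G \<Longrightarrow> y \<in> pverts G \<Longrightarrow> (x, y) \<in> parcs G \<longleftrightarrow> (h x, h y) \<in> parcs H"
      by (auto simp: pair_iso_def)
    define f :: "('a, 'a \<times> 'a, 'b, 'b \<times> 'b) digraph_isomorphism" where
      "f = \<lparr> iso_verts = h, iso_arcs = map_prod h h, iso_head = snd, iso_tail = fst \<rparr>"
    have inj: "inj_on h (pverts G)" using h(1) by (simp add: bij_betw_def)
    have "parcs G \<subseteq> pverts G \<times> pverts G" using G.wellformed' by auto
    then have "inj_on (map_prod h h) (parcs G)"
      using map_prod_inj_on[OF inj inj] inj_on_subset by blast
    then have "G.digraph_isomorphism f"
      using inj G.wf_digraph by (auto simp: G.digraph_isomorphism_def f_def)
    moreover have "parcs H = map_prod h h ` parcs G"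
    proof
      show "map_prod h h ` parcs G \<subseteq> parcs H"
      proof (rule image_subsetI)
        fix e assume e: "e \<in> parcs G"
        then show "map_prod h h e \<in> parcs H"
          using h(2)[of "fst e" "snd e"] G.arc_fst_in_verts[OF e] G.arc_snd_in_verts[OF e]
          by (cases e) simp
      qed
      show "parcs H \<subseteq> map_prod h h ` parcs G"
      proof
        fix e assume e: "e \<in> parcs H"
        then have "fst e \<in> h ` pverts G" "snd e \<in> h ` pverts G"
          using h(1) H.arc_fst_in_verts H.arc_snd_in_verts by (auto simp: bij_betw_def)
        then obtain x y where xy: "x \<in> pverts G" "y \<in> pverts G" "e = (h x, h y)"
          by (metis imageE prod.collapse)
        then have "(x, y) \<in> parcs G" using h(2)[of x y] e by simp
        then show "e \<in> map_prod h h ` parcs G" using xy(3) by (metis imageI map_prod_simp)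
      qed
    qed
    then have "with_proj H = app_iso f (with_proj G)"
      using h(1) by (simp add: with_proj_def app_iso_def f_def bij_betw_def)
    ultimately show "digraph_iso (with_proj G) (with_proj H)"
      unfolding digraph_iso_def by blast
  qed
qed

lemma pair_iso_sym:
  assumes "pair_iso h G H"
  shows "pair_iso (inv_into (pverts G) h) H G"
proof -
  have h: "bij_betw h (pverts G) (pverts H)"
    "\<And>x y. x \<in> pverts G \<Longrightarrow> y \<in> pverts G \<Longrightarrow> (x, y) \<in> parcs G \<longleftrightarrow> (h x, h y) \<in> parcs H"
    using assms by (auto simp: pair_iso_def)
  let ?g = "inv_into (pverts G) h"
  have g: "h (?g y) = y" "?g y \<in> pverts G" if "y \<in> pverts H" for y
    using bij_betw_inv_into_right[OF h(1) that] bij_betw_apply[OF bij_betw_inv_into[OF h(1)] that]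
    by auto
  have "(x, y) \<in> parcs H \<longleftrightarrow> (?g x, ?g y) \<in> parcs G" if "x \<in> pverts H" "y \<in> pverts H" for x y
    using h(2)[OF g(2)[OF that(1)] g(2)[OF that(2)]] g(1)[OF that(1)] g(1)[OF that(2)] by simp
  then show ?thesis
    using bij_betw_inv_into[OF h(1)] by (simp add: pair_iso_def)
qed

lemma nbhd_pair_iso:
  assumes "pair_graph G" "pair_graph H" "pair_iso h G H" "x \<in> pverts G"
  shows "nbhd H (h x) = h ` nbhd G x"
proof -
  interpret G: pair_graph G by fact
  interpret H: pair_graph H by fact
  have V: "pverts H = h ` pverts G"
    and E: "\<And>y. y \<in> pverts G \<Longrightarrow> (x, y) \<in> parcs G \<longleftrightarrow> (h x, h y) \<in> parcs H"
    using assms(3,4) by (auto simp: pair_iso_def bij_betw_def)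
  show ?thesis
  proof
    show "h ` nbhd G x \<subseteq> nbhd H (h x)"
      using E G.nbhd_subset[of x] by (auto simp: nbhd_def)
    show "nbhd H (h x) \<subseteq> h ` nbhd G x"
    proof
      fix z assume z: "z \<in> nbhd H (h x)"
      then obtain y where "y \<in> pverts G" "z = h y" using H.nbhd_subset V by blast
      then show "z \<in> h ` nbhd G x" using z E[of y] by (simp add: nbhd_def)
    qed
  qed
qed

lemma card_nbhd_pair_iso:
  assumes "pair_graph G" "pair_graph H" "pair_iso h G H" "x \<in> pverts G"
  shows "card (nbhd H (h x)) = card (nbhd G x)"
proof -
  have "inj_on h (nbhd G x)"
    using assms(3) inj_on_subset[OF _ pair_graph.nbhd_subset[OF assms(1)]]
    unfolding pair_iso_def bij_betw_def by blast
  then show ?thesis using nbhd_pair_iso[OF assms] by (simp add: card_image)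
qed

text \<open>Pulling back along \<open>h\<close> keeps the set of colors, and \<open>h\<close>
  matches the color classes on corresponding neighborhoods.\<close>

lemma pcf_coloring_pair_iso:
  assumes G: "pair_graph G" and H: "pair_graph H"
    and iso: "pair_iso h G H" and c: "pcf_coloring H k c"
  shows "pcf_coloring G k (c \<circ> h)"
proof -
  have bij: "bij_betw h (pverts G) (pverts H)" using iso by (simp add: pair_iso_def)
  then have V: "h ` pverts G = pverts H" and inj: "inj_on h (pverts G)"
    by (auto simp: bij_betw_def)
  have "card ((c \<circ> h) ` pverts G) \<le> k"
    unfolding image_comp[symmetric] V using c by (simp add: pcf_coloring_def)
  moreover have "proper_coloring G (c \<circ> h)"
    unfolding proper_coloring_def
  proof safe
    fix x y assume xy: "(x, y) \<in> parcs G" and eq: "(c \<circ> h) x = (c \<circ> h) y"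
    interpret G: pair_graph G by fact
    have "(h x, h y) \<in> parcs H"
      using iso xy G.wellformed'[OF xy] unfolding pair_iso_def by blast
    then show False using eq c by (auto simp: pcf_coloring_def proper_coloring_def)
  qed
  moreover have "conflict_free G (c \<circ> h)"
    unfolding conflict_free_def
  proof (intro ballI impI)
    fix x assume x: "x \<in> pverts G" "nbhd G x \<noteq> {}"
    have N: "nbhd H (h x) = h ` nbhd G x" by (rule nbhd_pair_iso[OF G H iso x(1)])
    have "h x \<in> pverts H" "nbhd H (h x) \<noteq> {}" using x V N by auto
    then obtain i where i: "card {y \<in> nbhd H (h x). c y = i} = 1"
      using c unfolding pcf_coloring_def conflict_free_def by blast
    have "{y \<in> nbhd H (h x). c y = i} = h ` {y \<in> nbhd G x. (c \<circ> h) y = i}"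
      using N by auto
    moreover have "inj_on h {y \<in> nbhd G x. (c \<circ> h) y = i}"
      by (rule inj_on_subset[OF inj]) (use pair_graph.nbhd_subset[OF G, of x] in blast)
    ultimately have "card {y \<in> nbhd G x. (c \<circ> h) y = i} = 1"
      using i by (simp add: card_image)
    then show "\<exists>i. card {y \<in> nbhd G x. (c \<circ> h) y = i} = 1" by blast
  qed
  ultimately show ?thesis by (simp add: pcf_coloring_def)
qed

lemma pcf_chromatic_number_pair_iso:
  assumes "pair_graph G" "pair_graph H" "pair_iso h G H"
  shows "pcf_chromatic_number G = pcf_chromatic_number H"
proof (rule antisym)
  show "pcf_chromatic_number G \<le> pcf_chromatic_number H"
    using pcf_chromatic_number_attained[OF assms(2)] pcf_coloring_pair_iso[OF assms]
      pcf_chromatic_number_le by blast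
  show "pcf_chromatic_number H \<le> pcf_chromatic_number G"
    using pcf_chromatic_number_attained[OF assms(1)] pcf_chromatic_number_le
      pcf_coloring_pair_iso[OF assms(2,1) pair_iso_sym[OF assms(3)]] by blast
qed

section \<open>Cycles\<close>

text \<open>Centering at \<open>Suc i mod n\<close> describes both neighbors without subtraction
  modulo \<open>n\<close>; by \<open>ex_Suc_mod\<close> every vertex has this form.\<close>

lemma nbhd_cycle_graph:
  assumes "i < n"
  shows "nbhd (cycle_graph n) (Suc i mod n) = {i, Suc (Suc i) mod n}"
  using assms by (auto simp: nbhd_def cycle_graph_def mod_Suc split: if_splits)

lemma ex_Suc_mod:
  assumes "j < (n::nat)"
  obtains i where "i < n" "j = Suc i mod n"
proof (cases j)
  case 0
  then show thesis using assms that[of "n - 1"] by simp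
next
  case (Suc i)
  then show thesis using assms that[of i] by simp
qed

text \<open>A closed sequence built from blocks \<open>0123\<close> and \<open>012\<close>; a length \<open>n \<ge> 3\<close> is of the form
  \<open>4b + 3a\<close> unless \<open>n = 5\<close>.\<close>

lemma cyclic_four_coloring:
  assumes "3 \<le> n" "n \<noteq> 5"
  obtains col :: "nat \<Rightarrow> nat" where "\<And>i. col i < 4"
    and "\<And>i. i < n \<Longrightarrow> col i \<noteq> col (Suc i mod n)"
    and "\<And>i. i < n \<Longrightarrow> col i \<noteq> col (Suc (Suc i) mod n)"
proof -
  \<comment> \<open>The number of blocks \<open>0123\<close>: \<open>4 * b\<close> is congruent to
    \<open>n\<close> modulo 3, and for \<open>n\<close> at least 3 it exceeds \<open>n\<close> only
    if \<open>n = 5\<close>.\<close>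
  define b where "b = n mod 3"
  define col where "col i = (if i < 4 * b then i mod 4 else (i - 4 * b) mod 3)" for i
  have n: "\<exists>a. n = 4 * b + 3 * a"
    using assms unfolding b_def by presburger
  \<comment> \<open>The cases say where the window of three positions lies relative to the change of
    block type at \<open>4 * b\<close>.\<close>
  have block: "col i \<noteq> col (Suc i) \<and> col i \<noteq> col (Suc (Suc i))" for i
  proof -
    consider "Suc (Suc i) < 4 * b" | "Suc (Suc i) = 4 * b" | "Suc i = 4 * b" | "4 * b \<le> i"
      by linarith
    then show ?thesis
    proof cases
      case 1
      moreover have "i mod 4 \<noteq> Suc i mod 4" "i mod 4 \<noteq> Suc (Suc i) mod 4" by presburger+
      ultimately show ?thesis by (simp add: col_def)
    next
      case 2
      then have "i mod 4 = 2" "Suc i mod 4 = 3" by presburger+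
      then show ?thesis using 2 by (simp add: col_def)
    next
      case 3
      then have "i mod 4 = 3" by presburger
      then show ?thesis using 3 by (simp add: col_def flip: 3)
    next
      case 4
      then obtain t where t: "i = 4 * b + t" using le_Suc_ex by blast
      have "t mod 3 \<noteq> Suc t mod 3" "t mod 3 \<noteq> Suc (Suc t) mod 3" by presburger+
      then show ?thesis
        using t by (simp add: col_def Suc_diff_le)
    qed
  qed
  obtain a where a: "n = 4 * b + 3 * a" using n by blast
  \<comment> \<open>\<open>col\<close> continues past \<open>n\<close> exactly as it starts at 0, so
    \<open>block\<close> also covers the positions that wrap around.\<close>
  have n01: "col n = 0" "col (Suc n) = 1" by (simp_all add: col_def a Suc_diff_le mod_Suc)
  have start: "col 0 = 0" "col 1 = 1" by (cases "b = 0"; simp add: col_def)+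
  have wrap: "col (Suc i mod n) = col (Suc i)" if "i < n" for i
    using that n01 start by (cases "Suc i = n") auto
  have wrap2: "col (Suc (Suc i) mod n) = col (Suc (Suc i))" if "i < n" for i
  proof (cases "Suc i = n")
    case True
    then have "Suc (Suc i) mod n = 1" using assms by (simp add: mod_Suc)
    then show ?thesis using n01 start True by simp
  next
    case False
    then show ?thesis using wrap[of "Suc i"] that by simp
  qed
  show thesis
  proof (rule that)
    fix i
    have "(i - 4 * b) mod 3 < 4" by (rule less_trans[of _ 3]) simp_all
    then show "col i < 4" by (simp add: col_def)
    show "col i \<noteq> col (Suc i mod n)" if "i < n" using block wrap[OF that] by simp
    show "col i \<noteq> col (Suc (Suc i) mod n)" if "i < n" using block wrap2[OF that] by simp
  qed
qed

text \<open>Distinct colors at distance one make the coloring proper; distinct colors two steps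
  apart separate the two neighbors of each vertex.\<close>

lemma pcf_chromatic_number_cycle_le:
  assumes "3 \<le> n" "n \<noteq> 5"
  shows "pcf_chromatic_number (cycle_graph n) \<le> 4"
proof -
  obtain col :: "nat \<Rightarrow> nat" where col: "\<And>i. col i < 4"
    "\<And>i. i < n \<Longrightarrow> col i \<noteq> col (Suc i mod n)"
    "\<And>i. i < n \<Longrightarrow> col i \<noteq> col (Suc (Suc i) mod n)"
    using cyclic_four_coloring[OF assms] by blast
  have "pcf_coloring (cycle_graph n) 4 col"
  proof (rule pcf_coloringI)
    show "proper_coloring (cycle_graph n) col"
      using col(2) by (fastforce simp: proper_coloring_def cycle_graph_def)
    fix x assume "x \<in> pverts (cycle_graph n)"
    then have "x < n" by (simp add: cycle_graph_def)
    then obtain i where i: "i < n" "x = Suc i mod n" by (rule ex_Suc_mod)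
    then show "\<exists>y \<in> nbhd (cycle_graph n) x. \<forall>z \<in> nbhd (cycle_graph n) x. z \<noteq> y \<longrightarrow> col z \<noteq> col y"
      using col(3)[of i] nbhd_cycle_graph[of i n] by (intro bexI[of _ i]) auto
  qed (rule col(1))
  then show ?thesis by (rule pcf_chromatic_number_le)
qed

text \<open>Any two vertices of the 5-cycle are adjacent or have a common neighbor whose only
  neighbors they are. Either way their colors differ, so all five colors are distinct.\<close>

lemma pcf_chromatic_number_C5: "pcf_chromatic_number (cycle_graph 5) = 5"
proof (rule antisym)
  have G: "pair_graph (cycle_graph 5)" by (rule pair_graph_cycle_graph) simp
  have V: "pverts (cycle_graph 5) = {..<5}" by (simp add: cycle_graph_def)
  show "pcf_chromatic_number (cycle_graph 5) \<le> 5"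
    using pcf_coloring_exists[OF G] pcf_chromatic_number_le V by (metis card_lessThan)
  obtain c where c: "pcf_coloring (cycle_graph 5) (pcf_chromatic_number (cycle_graph 5)) c"
    using pcf_chromatic_number_attained[OF G] by blast
  have ne1: "c i \<noteq> c (Suc i mod 5)" if "i < 5" for i
    using c that by (auto simp: pcf_coloring_def proper_coloring_def cycle_graph_def)
  have ne2: "c i \<noteq> c (Suc (Suc i) mod 5)" if "i < 5" for i
  proof
    let ?j = "Suc (Suc i) mod 5"
    assume eq: "c i = c ?j"
    have N: "nbhd (cycle_graph 5) (Suc i mod 5) = {i, ?j}"
      using nbhd_cycle_graph that by blast
    have "i \<noteq> ?j" using that by presburger
    have "Suc i mod 5 \<in> pverts (cycle_graph 5)" by (simp add: V)
    then obtain k where "card {y \<in> {i, ?j}. c y = k} = 1"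
      using c N by (auto simp: pcf_coloring_def conflict_free_def)
    \<comment> \<open>With equal colors, each color occurs twice or never on this
      neighborhood.\<close>
    moreover have "{y \<in> {i, ?j}. c y = k} = (if k = c i then {i, ?j} else {})"
      using eq by auto
    ultimately show False using \<open>i \<noteq> ?j\<close> by (simp split: if_splits)
  qed
  have "inj_on c {..<5}"
  proof (rule linorder_inj_onI')
    fix i j :: nat assume ij: "i \<in> {..<5}" "j \<in> {..<5}" "i < j"
    \<comment> \<open>Differences 3 and 4 are two steps and one step from \<open>j\<close> on to
      \<open>i\<close> around the cycle.\<close>
    then consider "j = Suc i" | "j = Suc (Suc i)" | "j = i + 3" | "j = i + 4"
      unfolding lessThan_iff by linarith
    then show "c i \<noteq> c j"
    proof cases
      case 1
      then show ?thesis using ij ne1[of i] by simp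
    next
      case 2
      then show ?thesis using ij ne2[of i] by simp
    next
      case 3
      then have "Suc (Suc j) mod 5 = i" using ij by simp
      then show ?thesis using ij ne2[of j] by simp
    next
      case 4
      then have "Suc j mod 5 = i" using ij by simp
      then show ?thesis using ij ne1[of j] by simp
    qed
  qed
  then have "card (c ` pverts (cycle_graph 5)) = 5" by (simp add: V card_image)
  then show "5 \<le> pcf_chromatic_number (cycle_graph 5)"
    using c by (simp add: pcf_coloring_def)
qed

section \<open>Maximum degree two, the extremal graphs and the strict bound\<close>

context pair_graph
begin

text \<open>Walk along the graph without turning back until the first repetition, which can only occur
  at the starting vertex.\<close>

lemma two_regular_imp_cycle:
  assumes conn: "connected (with_proj G)"
    and two: "\<And>v. v \<in> pverts G \<Longrightarrow> card (nbhd G v) = 2"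
  obtains n h where "3 \<le> n" "pair_iso h (cycle_graph n) G"
proof -
  obtain r where r: "r \<in> pverts G" using connected_imp_verts_nonempty[OF conn] by blast
  obtain s where s: "s \<in> nbhd G r"
    using two[OF r] by (metis card.empty ex_in_conv zero_neq_numeral)
  \<comment> \<open>Yields \<open>nxt u v\<close>, the continuation of the walk on arriving at
    \<open>v\<close> from \<open>u\<close>.\<close>
  have "\<exists>z. u \<in> nbhd G v \<longrightarrow> nbhd G v = {u, z} \<and> z \<noteq> u" for u v
  proof (cases "u \<in> nbhd G v")
    case True
    then have "v \<in> pverts G" using nbhd_sym[of u v] nbhd_subset[of u] by blast
    then have "card (nbhd G v - {u}) = 1" using two True by simp
    then obtain z where "nbhd G v - {u} = {z}" by (auto simp: card_1_singleton_iff)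
    then show ?thesis using True by blast
  qed blast
  then obtain nxt where nxt: "\<And>u v. u \<in> nbhd G v \<Longrightarrow> nbhd G v = {u, nxt u v} \<and> nxt u v \<noteq> u"
    by metis
  \<comment> \<open>The state of the walk is its current arc; \<open>p i\<close> is the tail of that
    arc.\<close>
  define q where "q i = ((\<lambda>(u, v). (v, nxt u v)) ^^ i) (r, s)" for i
  define p where "p i = fst (q i)" for i
  have q_Suc: "q (Suc i) = (snd (q i), nxt (fst (q i)) (snd (q i)))" for i
    by (simp add: q_def case_prod_beta)
  have step: "p i \<in> nbhd G (p (Suc i)) \<and> p (Suc i) = snd (q i)" for i
  proof (induction i)
    case 0
    then show ?case using s nbhd_sym[of s r] by (simp add: p_def q_Suc) (simp add: q_def)
  next
    case (Suc i)
    then have "nxt (p i) (p (Suc i)) \<in> nbhd G (p (Suc i))" using nxt by blast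
    then show ?case using Suc nbhd_sym by (simp add: p_def q_Suc)
  qed
  have adj: "p i \<in> nbhd G (p (Suc i))" for i using step by blast
  have N: "nbhd G (p (Suc i)) = {p i, p (Suc (Suc i))} \<and> p (Suc (Suc i)) \<noteq> p i" for i
    using nxt[of "p i" "p (Suc i)"] step[of i] by (simp add: p_def q_Suc)
  have adj': "p i \<noteq> p (Suc i)" for i using adj[of i] nbhd_irrefl by metis
  have pV: "p i \<in> pverts G" for i using adj[of i] nbhd_subset by blast
  have "\<not> inj p"
    using pV pair_finite_verts finite_imageD[of p UNIV] finite_subset[of "range p"]
    by (metis image_subsetI infinite_UNIV_nat)
  then have ex: "\<exists>n. \<exists>j<n. p n = p j"
    by (metis injI linorder_neqE_nat)
  define n where "n = (LEAST n. \<exists>j<n. p n = p j)"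
  have least: "\<not> (\<exists>j<m. p m = p j)" if "m < n" for m
    using that not_less_Least unfolding n_def by blast
  have "\<exists>j<n. p n = p j"
    unfolding n_def using ex by (rule LeastI_ex)
  then obtain j where j: "j < n" "p n = p j" by blast
  have inj: "inj_on p {..<n}"
    by (rule linorder_inj_onI') (use least in force)
  have "n \<noteq> 1" using j adj'[of 0] by auto
  moreover have "n \<noteq> 2"
  proof
    assume "n = 2"
    then have "j = 0 \<or> j = 1" using j by auto
    then show False using \<open>n = 2\<close> j adj'[of 1] N[of 0] by (auto simp: numeral_2_eq_2)
  qed
  ultimately have n3: "3 \<le> n" using j by linarith
  obtain n' where n': "n = Suc n'" using n3 by (cases n) auto
  \<comment> \<open>Otherwise \<open>p n'\<close> is a neighbor of \<open>p j\<close> and hence one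
    of the two vertices next to \<open>p j\<close> on the walk. As the first \<open>n\<close>
    vertices are distinct, \<open>n\<close> would be \<open>j + 1\<close> or \<open>j + 2\<close>,
    against \<open>adj'\<close> or \<open>N\<close>.\<close>
  have "j = 0"
  proof (rule ccontr)
    assume "j \<noteq> 0"
    then obtain i where i: "j = Suc i" by (cases j) auto
    have "p n' \<in> {p i, p (Suc (Suc i))}"
      using adj[of n'] N[of i] j i n' by metis
    moreover have "p n' \<noteq> p i" using inj_on_eq_iff[OF inj, of n' i] j i n' by simp
    ultimately have "p n' = p (Suc (Suc i))" by simp
    moreover have "Suc (Suc i) \<le> n" using j i by simp
    ultimately have "n' = Suc (Suc i) \<or> Suc (Suc i) = n"
      using inj_on_eq_iff[OF inj, of n' "Suc (Suc i)"] n' by (cases "Suc (Suc i) = n") simp_all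
    then show False using N[of j] adj'[of j] i j n' by auto
  qed
  then have pn: "p n = p 0" using j by simp
  have N0: "nbhd G (p 0) = {p 1, p n'}"
  proof -
    have "p n' \<in> nbhd G (p 0)" using adj[of n'] pn n' by metis
    moreover have "p 1 \<in> nbhd G (p 0)" using adj[of 0] nbhd_sym[of "p 0" "p 1"] by simp
    moreover have "p 1 \<noteq> p n'" using inj_on_eq_iff[OF inj, of 1 n'] n3 n' by simp
    moreover have "\<exists>z. nbhd G (p 0) = {p 1, z} \<and> z \<noteq> p 1"
      using nxt[of "p 1" "p 0"] calculation(2) by blast
    ultimately show ?thesis by auto
  qed
  \<comment> \<open>Adding \<open>n' = n - 1\<close> modulo \<open>n\<close> is the predecessor
    map.\<close>
  have pmod: "nbhd G (p i) = {p (Suc i mod n), p ((i + n') mod n)}" if "i < n" for i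
  proof (cases i)
    case 0
    then show ?thesis using N0 n3 n' by simp
  next
    case (Suc k)
    have "i + n' = k + n" using Suc n' by simp
    then have 1: "(i + n') mod n = k"
      using Suc that by (metis Suc_lessD mod_add_self2 mod_less)
    have "p (Suc i mod n) = p (Suc i)"
      using that pn by (cases "Suc i = n") auto
    then show ?thesis using N[of k] Suc 1 by (auto simp: insert_commute)
  qed
  have "p ` {..<n} = pverts G"
  proof (rule nbhd_closed_eq_verts[OF conn])
    show "p ` {..<n} \<subseteq> pverts G" using pV by blast
    show "p 0 \<in> p ` {..<n}" using n3 by simp
    fix x assume "x \<in> p ` {..<n}"
    then show "nbhd G x \<subseteq> p ` {..<n}" using pmod n3 by auto
  qed
  then have "bij_betw p (pverts (cycle_graph n)) (pverts G)"
    using inj by (simp add: bij_betw_def cycle_graph_def)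
  moreover have "(x, y) \<in> parcs (cycle_graph n) \<longleftrightarrow> (p x, p y) \<in> parcs G"
    if "x < n" "y < n" for x y
  proof -
    have "(p x, p y) \<in> parcs G \<longleftrightarrow> p y \<in> nbhd G (p x)" by (simp add: nbhd_def)
    also have "\<dots> \<longleftrightarrow> y = Suc x mod n \<or> y = (x + n') mod n"
      using pmod[OF that(1)] inj_on_eq_iff[OF inj, of y "Suc x mod n"]
        inj_on_eq_iff[OF inj, of y "(x + n') mod n"] that n3 by simp
    also have "y = (x + n') mod n \<longleftrightarrow> x = Suc y mod n"
    proof (cases x)
      case 0
      then show ?thesis using that n' by (auto simp: mod_Suc)
    next
      case (Suc k)
      then have "x + n' = k + n" using n' by simp
      then have "(x + n') mod n = k"
        using Suc that by (metis Suc_lessD mod_add_self2 mod_less)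
      then show ?thesis using Suc that by (auto simp: mod_Suc)
    qed
    finally show ?thesis using that by (auto simp: cycle_graph_def)
  qed
  ultimately have "pair_iso p (cycle_graph n) G"
    by (auto simp: pair_iso_def cycle_graph_def)
  then show thesis using that n3 by blast
qed

text \<open>A vertex of smaller degree gives the bound 4 directly; otherwise the graph is a cycle of
  length other than 5.\<close>

lemma pcf_chromatic_number_le_max_degree_2:
  assumes conn: "connected (with_proj G)" and max: "max_degree G = 2"
    and not_C5: "\<not> digraph_iso (with_proj G) (with_proj (cycle_graph 5))"
  shows "pcf_chromatic_number G \<le> 4"
proof (cases "\<exists>r \<in> pverts G. card (nbhd G r) < 2")
  case True
  then show ?thesis using pcf_chromatic_number_le_irregular[OF conn] max by fastforce
next
  case False
  then have "card (nbhd G v) = 2" if "v \<in> pverts G" for v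
    using that card_nbhd_le[OF that] max by force
  then obtain n h where n: "3 \<le> n" and h: "pair_iso h (cycle_graph n) G"
    using two_regular_imp_cycle[OF conn] by blast
  have C: "pair_graph (cycle_graph n)" using n by (rule pair_graph_cycle_graph)
  have "n \<noteq> 5"
    using not_C5 pair_iso_sym[OF h] digraph_iso_with_proj_iff[OF pair_graph C] by blast
  then show ?thesis
    using pcf_chromatic_number_cycle_le[OF n] pcf_chromatic_number_pair_iso[OF C pair_graph h]
    by simp
qed

text \<open>The chromatic number gives equality at degree 2, and the degree excludes this graph when
  \<Delta> is at least 3.\<close>

lemma C5_invariants:
  assumes "pverts G \<noteq> {}" "digraph_iso (with_proj G) (with_proj (cycle_graph 5))"
  shows "max_degree G = 2" "pcf_chromatic_number G = 5"
proof -
  have C: "pair_graph (cycle_graph 5)" by (rule pair_graph_cycle_graph) simp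
  obtain h where h: "pair_iso h G (cycle_graph 5)"
    using assms(2) digraph_iso_with_proj_iff[OF pair_graph C] by blast
  obtain x where x: "x \<in> pverts G" "card (nbhd G x) = max_degree G"
    using max_degree_attained[OF assms(1)] by blast
  have "h x \<in> pverts (cycle_graph 5)"
    using h x by (auto simp: pair_iso_def bij_betw_def)
  then have "h x < 5" by (simp add: cycle_graph_def)
  then obtain i where i: "i < 5" "h x = Suc i mod 5" by (rule ex_Suc_mod)
  have "i \<noteq> Suc (Suc i) mod 5" using i by presburger
  then have "card (nbhd (cycle_graph 5) (h x)) = 2"
    using nbhd_cycle_graph[OF i(1)] i(2) by simp
  then show "max_degree G = 2"
    using card_nbhd_pair_iso[OF pair_graph C h x(1)] x(2) by simp
  show "pcf_chromatic_number G = 5"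
    using pcf_chromatic_number_pair_iso[OF pair_graph C h] pcf_chromatic_number_C5 by simp
qed

text \<open>The ends of an edge have no further neighbors, so by connectivity they are the whole
  graph.\<close>

lemma max_degree_1_imp_K2:
  assumes conn: "connected (with_proj G)" and max: "max_degree G = 1"
  shows "complete_digraph 2 (with_proj G)"
proof -
  have "pverts G \<noteq> {}" using connected_imp_verts_nonempty[OF conn] by blast
  then obtain a where a: "a \<in> pverts G" "card (nbhd G a) = 1"
    using max_degree_attained max by metis
  then obtain b where b: "nbhd G a = {b}" by (auto simp: card_1_singleton_iff)
  have ba: "a \<in> nbhd G b" "b \<in> pverts G" "a \<noteq> b"
    using b nbhd_sym[of b a] nbhd_subset[of a] nbhd_irrefl[of a] by auto
  then have "card (nbhd G b) = 1"
    using card_nbhd_le[of b] max finite_nbhd[of b] card_gt_0_iff[of "nbhd G b"] by force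
  then have b': "nbhd G b = {a}" using ba by (auto simp: card_1_singleton_iff)
  have V: "{a, b} = pverts G"
    by (rule nbhd_closed_eq_verts[OF conn, of _ a]) (use a ba b b' in auto)
  have "(u, v) \<in> parcs G \<longleftrightarrow> u \<in> pverts G \<and> v \<in> pverts G \<and> u \<noteq> v" for u v
  proof -
    have "(u, v) \<in> parcs G \<longleftrightarrow> v \<in> nbhd G u" by (simp add: nbhd_def)
    moreover have "u \<in> pverts G" if "(u, v) \<in> parcs G" using that wellformed' by blast
    ultimately show ?thesis using b b' \<open>a \<noteq> b\<close> unfolding V[symmetric] by auto
  qed
  then have "parcs G = {(u, v). (u, v) \<in> pverts G \<times> pverts G \<and> u \<noteq> v}" by auto
  moreover have "card (pverts G) = 2" using V ba by (metis card_2_iff)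
  ultimately show ?thesis
    using pair_graphD_graph by (simp add: complete_digraph_def)
qed

lemma K2_invariants:
  assumes "complete_digraph 2 (with_proj G)"
  shows "max_degree G = 1" "pcf_chromatic_number G = 2"
proof -
  have card: "card (pverts G) = 2"
    and E: "parcs G = {(u, v). (u, v) \<in> pverts G \<times> pverts G \<and> u \<noteq> v}"
    using assms by (auto simp: complete_digraph_def)
  then obtain a b where V: "pverts G = {a, b}" "a \<noteq> b" by (auto simp: card_2_iff)
  obtain x where x: "x \<in> pverts G" "card (nbhd G x) = max_degree G"
    using max_degree_attained V by blast
  have "nbhd G x = pverts G - {x}" using x E by (auto simp: nbhd_def)
  then show "max_degree G = 1" using x card by simp
  show "pcf_chromatic_number G = 2"
  proof (rule antisym)
    show "pcf_chromatic_number G \<le> 2"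
      using pcf_coloring_exists[OF pair_graph] pcf_chromatic_number_le card by metis
    obtain c where c: "pcf_coloring G (pcf_chromatic_number G) c"
      using pcf_chromatic_number_attained[OF pair_graph] by blast
    have "(a, b) \<in> parcs G" using E V by auto
    then have "c a \<noteq> c b" using c by (auto simp: pcf_coloring_def proper_coloring_def)
    then have "card (c ` pverts G) = 2" using V by simp
    then show "2 \<le> pcf_chromatic_number G" using c by (simp add: pcf_coloring_def)
  qed
qed

text \<open>At degree 3 the greedy bound 7 equals the target, so the sharper bound 6 is taken from
  the irregular or the cubic case.\<close>

lemma pcf_chromatic_number_less:
  assumes conn: "connected (with_proj G)" and max: "3 \<le> max_degree G"
  shows "pcf_chromatic_number G < 5 * max_degree G div 2"
proof (cases "max_degree G = 3")
  case False
  then have "2 * max_degree G + 1 < 5 * max_degree G div 2" using max by linarith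
  then show ?thesis using pcf_chromatic_number_le_greedy by linarith
next
  case 3: True
  have "pcf_chromatic_number G \<le> 6"
  proof (cases "\<exists>r \<in> pverts G. card (nbhd G r) < 3")
    case True
    then show ?thesis using pcf_chromatic_number_le_irregular[OF conn] 3 by fastforce
  next
    case False
    then have "card (nbhd G v) = 3" if "v \<in> pverts G" for v
      using that card_nbhd_le[OF that] 3 by force
    then show ?thesis by (rule pcf_chromatic_number_le_cubic[OF conn])
  qed
  then show ?thesis using 3 by simp
qed

end

theorem corollary4p4:
  fixes G :: "'a pair_pre_digraph" and \<Delta> :: nat
  assumes "pair_graph G"
    and "connected (with_proj G)"
    and "max_degree G = \<Delta>"
    and "\<Delta> \<ge> 1"
  shows "int (pcf_chromatic_number G) \<le> \<lfloor>5 * real \<Delta> / 2\<rfloor>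
    \<and> (int (pcf_chromatic_number G) = \<lfloor>5 * real \<Delta> / 2\<rfloor> \<longleftrightarrow>
         complete_digraph 2 (with_proj G) \<or> digraph_iso (with_proj G) (with_proj (cycle_graph 5)))"
proof -
  interpret pair_graph G by fact
  have floor: "\<lfloor>5 * real \<Delta> / 2\<rfloor> = int (5 * \<Delta> div 2)"
    using floor_divide_of_nat_eq[of "5 * \<Delta>" 2, where ?'a = real] by simp
  have ne: "pverts G \<noteq> {}" by (rule connected_imp_verts_nonempty) fact
  let ?K2 = "complete_digraph 2 (with_proj G)"
  let ?C5 = "digraph_iso (with_proj G) (with_proj (cycle_graph 5))"
  \<comment> \<open>The target is 2 in the first case, where only \<open>?K2\<close> remains, and 5
    in the second, where all but \<open>?C5\<close> stay at most 4. In the third the bound is strict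
    and the degree rules out both graphs.\<close>
  consider "\<Delta> = 1" | "\<Delta> = 2" | "3 \<le> \<Delta>" using assms(4) by linarith
  then have "pcf_chromatic_number G \<le> 5 * \<Delta> div 2 \<and>
    (pcf_chromatic_number G = 5 * \<Delta> div 2 \<longleftrightarrow> ?K2 \<or> ?C5)"
  proof cases
    case 1
    then have ?K2 using max_degree_1_imp_K2 assms by blast
    then show ?thesis using K2_invariants(2) 1 by simp
  next
    case 2
    then show ?thesis
      using pcf_chromatic_number_le_max_degree_2[OF assms(2)] C5_invariants(2)[OF ne]
        K2_invariants(1) assms(3) by fastforce
  next
    case 3
    then show ?thesis
      using pcf_chromatic_number_less[OF assms(2)] C5_invariants(1)[OF ne]
        K2_invariants(1) assms(3) by fastforce
  qed
  then show ?thesis unfolding floor by simp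
qed

end
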